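(* Let $Y$ be a compact Hausdorff space without isolated points, and let $A\subset Y$ be a nonempty closed nowhere-dense subset (not necessarily finite). Then $X:=\mathrm{FMQ}(Y,A,\mathcal{D}_Y)$ is: (a) compact; (b) $T_1$; (c) connected; (d) US; (e) not KC; (f) not Hausdorff. If moreover every point of $Y\setminus A$ has a countable neighborhood base in $Y$, then $X$ is $k_2$-Hausdorff but not weakly Hausdorff. In particular (under this additional hypothesis), $X$ is $k_2$-Hausdorff, not weakly Hausdorff, not KC, and not $T_2$.
   Context: For a topological space $Y$ and nonempty $A\subseteq Y$, let $q\colon Y\to Y/A$ be the projection (of sets) collapsing $A$ to one point $\ast=q(A)$, and let $\mathcal{D}_Y$ be the collection of dense subsets of $Y$. $\mathrm{FMQ}(Y,A,\mathcal{D}_Y)$ is the set $Y/A$ with the topology consisting of all $U\subseteq Y/A$ such that $q^{-1}(U)$ is open in $Y$ and ($\ast\in U\Rightarrow q^{-1}(U)$ is dense in $Y$). "Compact" does not include Hausdorff. A space $X$ is US if every convergent sequence has a unique limit; KC if every compact subset is closed; weakly Hausdorff if for every compact Hausdorff $K$ and continuous $f\colon K\to X$ the image $f(K)$ is closed; $k_2$-Hausdorff if for every compact Hausdorff $K$ and continuous $f\colon K\to X$ the set $\{(a,b)\in K\times K:f(a)=f(b)\}$ is closed in $K\times K$. *)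

theory Defs
  imports "HOL-Analysis.Analysis"
begin

text \<open>The set \<open>Y/A\<close> consists of \<open>A\<close> itself (the collapsed point) and the singletons \<open>{y}\<close>
  with \<open>y\<close> not in \<open>A\<close>.\<close>

definition collapse :: "'a set \<Rightarrow> 'a \<Rightarrow> 'a set" where
  "collapse A y = (if y \<in> A then A else {y})"

definition collapse_vimage :: "'a topology \<Rightarrow> 'a set \<Rightarrow> 'a set set \<Rightarrow> 'a set" where
  "collapse_vimage Y A U = {y \<in> topspace Y. collapse A y \<in> U}"

definition dense_subsets :: "'a topology \<Rightarrow> 'a set set" where
  "dense_subsets Y = {S. S \<subseteq> topspace Y \<and> Y closure_of S = topspace Y}"

text \<open>The parameter \<open>D\<close> is the family in which preimages of neighbourhoods of the collapsed
  point must lie. For \<open>D = dense_subsets Y\<close> the sets below do form a topology, so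
  \<open>openin_FMQ_dense\<close> describes the open sets exactly; for arbitrary \<open>D\<close> they need not.\<close>

definition FMQ_open :: "'a topology \<Rightarrow> 'a set \<Rightarrow> 'a set set \<Rightarrow> 'a set set \<Rightarrow> bool" where
  "FMQ_open Y A D U \<longleftrightarrow>
     U \<subseteq> collapse A ` topspace Y \<and>
     openin Y (collapse_vimage Y A U) \<and>
     (A \<in> U \<longrightarrow> collapse_vimage Y A U \<in> D)"

definition FMQ :: "'a topology \<Rightarrow> 'a set \<Rightarrow> 'a set set \<Rightarrow> 'a set topology" where
  "FMQ Y A D = topology (FMQ_open Y A D)"

lemma istopology_FMQ_dense: "istopology (FMQ_open Y A (dense_subsets Y))"
  unfolding istopology_def
proof (intro conjI allI impI)
  fix S T
  assume S: "FMQ_open Y A (dense_subsets Y) S" and T: "FMQ_open Y A (dense_subsets Y) T"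
  have eq: "collapse_vimage Y A (S \<inter> T) = collapse_vimage Y A S \<inter> collapse_vimage Y A T"
    by (auto simp: collapse_vimage_def)
  have "Y closure_of (collapse_vimage Y A S \<inter> collapse_vimage Y A T) = topspace Y"
    if "A \<in> S" "A \<in> T"
  proof -
    have "openin Y (collapse_vimage Y A S)"
      and "Y closure_of (collapse_vimage Y A S) = topspace Y"
      and "Y closure_of (collapse_vimage Y A T) = topspace Y"
      using S T that by (auto simp: FMQ_open_def dense_subsets_def)
    then show ?thesis
      by (metis closure_of_openin_Int_superset openin_subset)
  qed
  then show "FMQ_open Y A (dense_subsets Y) (S \<inter> T)"
    using S T unfolding FMQ_open_def eq by (auto simp: dense_subsets_def)
next
  fix K
  assume K: "\<forall>U\<in>K. FMQ_open Y A (dense_subsets Y) U"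
  have eq: "collapse_vimage Y A (\<Union>K) = \<Union>(collapse_vimage Y A ` K)"
    by (auto simp: collapse_vimage_def)
  have op: "openin Y (collapse_vimage Y A (\<Union>K))"
    unfolding eq using K by (auto simp: FMQ_open_def)
  have "Y closure_of (collapse_vimage Y A (\<Union>K)) = topspace Y" if "U \<in> K" "A \<in> U" for U
  proof -
    have "Y closure_of (collapse_vimage Y A U) = topspace Y"
      using K that by (auto simp: FMQ_open_def dense_subsets_def)
    moreover have "collapse_vimage Y A U \<subseteq> collapse_vimage Y A (\<Union>K)"
      using that by (auto simp: collapse_vimage_def)
    ultimately show ?thesis
      by (metis closure_of_mono closure_of_subset_topspace subset_antisym)
  qed
  then show "FMQ_open Y A (dense_subsets Y) (\<Union>K)"
    using K op openin_subset[OF op] unfolding FMQ_open_def dense_subsets_def by blast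
qed

lemma openin_FMQ_dense:
  "openin (FMQ Y A (dense_subsets Y)) U \<longleftrightarrow> FMQ_open Y A (dense_subsets Y) U"
  by (simp add: FMQ_def topology_inverse' istopology_FMQ_dense)

lemma topspace_FMQ_dense: "topspace (FMQ Y A (dense_subsets Y)) = collapse A ` topspace Y"
proof
  show "topspace (FMQ Y A (dense_subsets Y)) \<subseteq> collapse A ` topspace Y"
    using openin_FMQ_dense[of Y A "topspace (FMQ Y A (dense_subsets Y))"]
    by (auto simp: FMQ_open_def)
  have "collapse_vimage Y A (collapse A ` topspace Y) = topspace Y"
    by (auto simp: collapse_vimage_def)
  then have "openin (FMQ Y A (dense_subsets Y)) (collapse A ` topspace Y)"
    by (simp add: openin_FMQ_dense) (simp add: FMQ_open_def dense_subsets_def)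
  then show "collapse A ` topspace Y \<subseteq> topspace (FMQ Y A (dense_subsets Y))"
    by (rule openin_subset)
qed

definition no_isolated_points :: "'a topology \<Rightarrow> bool" where
  "no_isolated_points Y \<longleftrightarrow> (\<forall>y\<in>topspace Y. \<not> openin Y {y})"

definition nowhere_dense_in :: "'a topology \<Rightarrow> 'a set \<Rightarrow> bool" where
  "nowhere_dense_in Y S \<longleftrightarrow> S \<subseteq> topspace Y \<and> Y interior_of (Y closure_of S) = {}"

text \<open>This is the pointwise condition in \<open>first_countable\<close>.\<close>

definition countable_nbhd_base_at :: "'a topology \<Rightarrow> 'a \<Rightarrow> bool" where
  "countable_nbhd_base_at Y y \<longleftrightarrow>
     (\<exists>\<B>. countable \<B> \<and> (\<forall>V\<in>\<B>. openin Y V \<and> y \<in> V) \<and>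
          (\<forall>U. openin Y U \<and> y \<in> U \<longrightarrow> (\<exists>V\<in>\<B>. V \<subseteq> U)))"

definition US_space :: "'a topology \<Rightarrow> bool" where
  "US_space X \<longleftrightarrow>
     (\<forall>s :: nat \<Rightarrow> 'a. \<forall>l m. range s \<subseteq> topspace X \<and>
        limitin X s l sequentially \<and> limitin X s m sequentially \<longrightarrow> l = m)"

text \<open>The next two notions quantify over all compact Hausdorff spaces \<open>K\<close>, which HOL cannot do
  inside a formula; \<open>K\<close> therefore ranges over the topologies on a type given as an argument. The
  full notion is the conjunction of the instances over all types. So to assert it, leave the type
  a free variable (theorems are universally quantified over it); to refute it, refute it for one
  concrete type.\<close>

definition weakly_Hausdorff_over :: "'k itself \<Rightarrow> 'a topology \<Rightarrow> bool" where
  "weakly_Hausdorff_over _ X \<longleftrightarrow>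
     (\<forall>(K :: 'k topology) f. compact_space K \<and> Hausdorff_space K \<and> continuous_map K X f
        \<longrightarrow> closedin X (f ` topspace K))"

definition k2_Hausdorff_over :: "'k itself \<Rightarrow> 'a topology \<Rightarrow> bool" where
  "k2_Hausdorff_over _ X \<longleftrightarrow>
     (\<forall>(K :: 'k topology) f. compact_space K \<and> Hausdorff_space K \<and> continuous_map K X f
        \<longrightarrow> closedin (prod_topology K K)
              {(a, b). a \<in> topspace K \<and> b \<in> topspace K \<and> f a = f b})"

end

theory Submission
  imports Defs
begin

text \<open>The image in \<open>X\<close> of a set \<open>C\<close> disjoint from \<open>A\<close> is closed iff \<open>C\<close> is closed with empty
  interior. Hence the image of a closed neighbourhood disjoint from \<open>A\<close> is compact but not closed,
  while a convergent sequence off \<open>A\<close> with its limit, having empty interior because \<open>Y\<close> has no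
  isolated points, stays closed in \<open>X\<close>. So sequences cannot see that the collapsed point fails to be
  separated from the others, and countable bases off \<open>A\<close> carry this over to maps from compact
  Hausdorff spaces.\<close>

section \<open>Spaces without isolated points, and convergent sequences in them\<close>

text \<open>In a T1 space all points but one of a finite open set can be removed, which would leave
  an isolated point.\<close>

lemma finite_openin_empty:
  assumes "t1_space Y" "no_isolated_points Y" "openin Y U" "finite U"
  shows "U = {}"
proof (rule ccontr)
  assume "U \<noteq> {}"
  then obtain u where u: "u \<in> U" by blast
  have sub: "U \<subseteq> topspace Y" using assms(3) by (rule openin_subset)
  have "closedin Y (U - {u})"
    using assms(1,4) sub by (auto simp: t1_space_closedin_finite)
  then have "openin Y (U - (U - {u}))" using assms(3) by (rule openin_diff[rotated])
  moreover have "U - (U - {u}) = {u}" using u by blast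
  ultimately show False using assms(2) u sub by (auto simp: no_isolated_points_def)
qed

text \<open>A point of an open \<open>W\<close> inside the set, if different from \<open>y\<close>,
  has a neighbourhood that avoids a tail of \<open>t\<close> and so meets \<open>W\<close> in
  finitely many points only. This is impossible without isolated points, and so is
  \<open>W = {y}\<close>.\<close>

lemma interior_of_convergent_sequence:
  assumes H: "Hausdorff_space Y" and N: "no_isolated_points Y" and L: "limitin Y t y sequentially"
  shows "Y interior_of (insert y (range t)) = {}"
  unfolding interior_of_eq_empty
proof (intro allI impI, elim conjE)
  fix W assume W: "openin Y W" "W \<subseteq> insert y (range t)"
  have t1_Y: "t1_space Y" using H by (rule Hausdorff_imp_t1_space)
  have "W \<subseteq> {y}"
  proof
    fix z assume z: "z \<in> W"
    have "z = y"
    proof (rule ccontr)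
      assume "z \<noteq> y"
      moreover have "z \<in> topspace Y" using z W(1) openin_subset by blast
      moreover have "y \<in> topspace Y" using L by (simp add: limitin_def)
      ultimately obtain P Q where PQ: "openin Y P" "openin Y Q" "z \<in> P" "y \<in> Q" "disjnt P Q"
        using H unfolding Hausdorff_space_def by metis
      obtain n0 where n0: "\<And>n. n0 \<le> n \<Longrightarrow> t n \<in> Q"
        using L PQ by (auto simp: limitin_sequentially)
      have "W \<inter> P \<subseteq> t ` {..<n0}"
      proof
        fix x assume x: "x \<in> W \<inter> P"
        then have "x \<notin> Q" using PQ(5) by (auto simp: disjnt_iff)
        then obtain n where "x = t n" using x W(2) PQ(4) by blast
        then show "x \<in> t ` {..<n0}" using n0 \<open>x \<notin> Q\<close> by (metis imageI lessThan_iff not_le)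
      qed
      then have "finite (W \<inter> P)" by (rule finite_subset) simp
      then have "W \<inter> P = {}" using finite_openin_empty[OF t1_Y N] W PQ by blast
      then show False using z PQ(3) by blast
    qed
    then show "z \<in> {y}" by simp
  qed
  then have "finite W" by (rule finite_subset) simp
  then show "W = {}" using finite_openin_empty[OF t1_Y N W(1)] by blast
qed

lemma countable_nbhd_base_at_sequence:
  assumes "countable_nbhd_base_at Y y" "y \<in> topspace Y"
  obtains V :: "nat \<Rightarrow> 'a set"
  where "\<And>n. openin Y (V n)" "\<And>n. y \<in> V n"
    "\<And>p. (\<And>n. p n \<in> V n) \<Longrightarrow> limitin Y p y sequentially"
proof -
  obtain B where B: "countable B" "\<And>V. V \<in> B \<Longrightarrow> openin Y V \<and> y \<in> V"
    "\<And>U. openin Y U \<Longrightarrow> y \<in> U \<Longrightarrow> \<exists>V\<in>B. V \<subseteq> U"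
    using assms(1) unfolding countable_nbhd_base_at_def by auto
  have ne: "B \<noteq> {}" using B(3)[of "topspace Y"] assms(2) by auto
  define b where "b = from_nat_into B"
  have b: "range b = B" unfolding b_def using ne B(1) by (rule range_from_nat_into)
  define V where "V n = (\<Inter>i\<le>n. b i)" for n
  show thesis
  proof
    show "openin Y (V n)" for n
      unfolding V_def using B(2) b by (intro openin_INT2) auto
    show "y \<in> V n" for n using B(2) b by (auto simp: V_def)
    show "limitin Y p y sequentially" if p: "\<And>n. p n \<in> V n" for p
      unfolding limitin_sequentially
    proof (intro conjI allI impI, fact, elim conjE)
      fix U assume "openin Y U" "y \<in> U"
      then obtain i where i: "b i \<subseteq> U" using B(3) b by blast
      have "p n \<in> U" if "i \<le> n" for n using p[of n] that i by (auto simp: V_def)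
      then show "\<exists>N. \<forall>n\<ge>N. p n \<in> U" by blast
    qed
  qed
qed

section \<open>The collapsing map and the topology of the quotient\<close>

lemma collapse_eq_self_iff: "collapse A y = A \<longleftrightarrow> y \<in> A"
  by (auto simp: collapse_def)

lemma collapse_notin: "y \<notin> A \<Longrightarrow> collapse A y = {y}"
  by (simp add: collapse_def)

lemma collapse_eq_iff:
  assumes "y \<notin> A" shows "collapse A z = collapse A y \<longleftrightarrow> z = y"
  using assms by (auto simp: collapse_def)

text \<open>The collapsing map is injective off \<open>A\<close>, so a set disjoint from
  \<open>A\<close> is saturated.\<close>

lemma collapse_in_image_iff:
  assumes "C \<inter> A = {}" shows "collapse A z \<in> collapse A ` C \<longleftrightarrow> z \<in> C"
proof
  assume "collapse A z \<in> collapse A ` C"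
  then obtain c where c: "c \<in> C" "collapse A z = collapse A c" by blast
  then have "z = c" using collapse_eq_iff[of c A z] assms by blast
  with c show "z \<in> C" by simp
qed blast

text \<open>Complements turn dense preimages into preimages with empty interior. Since nothing is
  assumed about \<open>A\<close>, the guard also asks that \<open>A\<close> be a point of the
  quotient.\<close>

lemma closedin_FMQ_dense:
  "closedin (FMQ Y A (dense_subsets Y)) F \<longleftrightarrow>
     F \<subseteq> collapse A ` topspace Y \<and> closedin Y (collapse_vimage Y A F) \<and>
     (A \<in> collapse A ` topspace Y - F \<longrightarrow> Y interior_of (collapse_vimage Y A F) = {})"
proof -
  have 1: "collapse_vimage Y A (collapse A ` topspace Y - F) = topspace Y - collapse_vimage Y A F"
    by (auto simp: collapse_vimage_def)
  have 2: "collapse_vimage Y A F \<subseteq> topspace Y" by (auto simp: collapse_vimage_def)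
  show ?thesis
    unfolding closedin_def topspace_FMQ_dense openin_FMQ_dense FMQ_open_def 1
    using 2 by (auto simp: dense_subsets_def interior_of_eq_empty_complement)
qed

lemma continuous_map_collapse:
  "continuous_map Y (FMQ Y A (dense_subsets Y)) (collapse A)"
  unfolding continuous_map_def topspace_FMQ_dense openin_FMQ_dense
  by (auto simp: FMQ_open_def collapse_vimage_def)

lemma compact_space_FMQ_dense:
  assumes "compact_space Y"
  shows "compact_space (FMQ Y A (dense_subsets Y))"
  using image_compactin[OF _ continuous_map_collapse, of Y "topspace Y" A] assms
  by (simp add: compact_space_def topspace_FMQ_dense)

text \<open>The image misses the collapsed point, so the density condition is vacuous.\<close>

lemma openin_FMQ_dense_image:
  assumes "openin Y V" "V \<inter> A = {}"
  shows "openin (FMQ Y A (dense_subsets Y)) (collapse A ` V)"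
proof -
  have sub: "V \<subseteq> topspace Y" using assms(1) by (rule openin_subset)
  have "collapse_vimage Y A (collapse A ` V) = V"
    using sub by (auto simp: collapse_vimage_def collapse_in_image_iff[OF assms(2)])
  moreover have "A \<notin> collapse A ` V"
    using assms(2) by (metis collapse_eq_self_iff disjoint_iff imageE)
  ultimately show ?thesis
    using assms(1) sub by (auto simp: openin_FMQ_dense FMQ_open_def)
qed

text \<open>\<open>C\<close> is the full preimage of its image, and the collapsed point lies in the
  complement of that image, so the interior condition is in force.\<close>

lemma closedin_FMQ_dense_image_iff:
  assumes "A \<noteq> {}" "A \<subseteq> topspace Y" "C \<subseteq> topspace Y" "C \<inter> A = {}"
  shows "closedin (FMQ Y A (dense_subsets Y)) (collapse A ` C) \<longleftrightarrow>
    closedin Y C \<and> Y interior_of C = {}"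
proof -
  have "collapse_vimage Y A (collapse A ` C) = C"
    using assms(3) by (auto simp: collapse_vimage_def collapse_in_image_iff[OF assms(4)])
  moreover have "A \<in> collapse A ` topspace Y - collapse A ` C"
    using assms by (metis DiffI collapse_eq_self_iff disjoint_iff equals0I imageE image_eqI subsetD)
  ultimately show ?thesis
    using assms(3) by (auto simp: closedin_FMQ_dense)
qed

section \<open>The standing assumptions, and closed sets of \<open>X\<close> from sequences\<close>

locale collapsed_space =
  fixes Y :: "'a topology" and A :: "'a set"
  assumes compact_Y: "compact_space Y" and Hausdorff_Y: "Hausdorff_space Y"
    and perfect_Y: "no_isolated_points Y"
    and A_nonempty: "A \<noteq> {}" and closed_A: "closedin Y A" and thin_A: "nowhere_dense_in Y A"
begin

abbreviation X where "X \<equiv> FMQ Y A (dense_subsets Y)"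
abbreviation q where "q \<equiv> collapse A"

lemma A_subset: "A \<subseteq> topspace Y"
  using closed_A by (rule closedin_subset)

lemma X_points:
  assumes "x \<in> topspace X"
  obtains "x = A" | y where "y \<in> topspace Y - A" "x = q y"
  using assms unfolding topspace_FMQ_dense by (metis DiffI collapse_eq_self_iff imageE)

lemma openin_complement: "openin Y (topspace Y - A)"
  using closed_A by blast

text \<open>The sequence with its limit is compact, hence closed in \<open>Y\<close>, and has empty
  interior. The complement of the image is then a neighbourhood of the collapsed point that avoids
  the whole sequence.\<close>

lemma closedin_X_limit:
  assumes L: "limitin Y t y sequentially" and y: "y \<notin> A" and t: "range t \<subseteq> topspace Y - A"
  shows "closedin X (q ` insert y (range t))"
proof -
  have "compactin Y (insert y (range t))"
    using L t by (intro compactin_sequence_with_limit) auto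
  then have "closedin Y (insert y (range t))"
    using Hausdorff_Y by (intro compactin_imp_closedin)
  moreover have "insert y (range t) \<subseteq> topspace Y"
    using calculation by (rule closedin_subset)
  moreover have "insert y (range t) \<inter> A = {}" using y t by blast
  ultimately show ?thesis
    using closedin_FMQ_dense_image_iff[OF A_nonempty A_subset]
      interior_of_convergent_sequence[OF Hausdorff_Y perfect_Y L] by blast
qed

section \<open>Compact images that are not closed\<close>

text \<open>Having empty interior, \<open>A\<close> is not all of \<open>Y\<close>; regularity then
  gives a point outside \<open>A\<close> a closed neighbourhood inside the open complement.\<close>

lemma closed_neighbourhood_off_A:
  obtains W C where "openin Y W" "W \<noteq> {}" "closedin Y C" "W \<subseteq> C" "C \<inter> A = {}"
proof -
  have "Y interior_of A = {}"
    using thin_A closed_A by (simp add: nowhere_dense_in_def closure_of_closedin)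
  then have "A \<noteq> topspace Y" using A_nonempty by (metis interior_of_topspace)
  then obtain y where y: "y \<in> topspace Y - A" using A_subset by blast
  have "neighbourhood_base_of (closedin Y) Y"
    unfolding neighbourhood_base_of_closedin
    using compact_Y Hausdorff_Y by (rule compact_Hausdorff_imp_regular_space)
  then obtain W C where "openin Y W" "closedin Y C" "y \<in> W" "W \<subseteq> C" "C \<subseteq> topspace Y - A"
    using y openin_complement unfolding neighbourhood_base_of by metis
  then show thesis by (intro that[of W C]) auto
qed

text \<open>A closed neighbourhood off \<open>A\<close> has nonempty interior, which the closedness
  criterion forbids. The same witness refutes both KC and weak Hausdorffness.\<close>

lemma closed_set_image_not_closed:
  obtains C where "closedin Y C" "\<not> closedin X (q ` C)"
proof -
  obtain W C where WC: "openin Y W" "W \<noteq> {}" "closedin Y C" "W \<subseteq> C" "C \<inter> A = {}"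
    by (rule closed_neighbourhood_off_A)
  have "Y interior_of C \<noteq> {}" using WC by (auto simp: interior_of_eq_empty)
  then have "\<not> closedin X (q ` C)"
    using closedin_FMQ_dense_image_iff[OF A_nonempty A_subset closedin_subset[OF WC(3)] WC(5)]
    by blast
  with WC(3) show thesis by (rule that)
qed

lemma not_kc_space: "\<not> kc_space X"
proof -
  obtain C where C: "closedin Y C" "\<not> closedin X (q ` C)" by (rule closed_set_image_not_closed)
  have "compactin X (q ` C)"
    using closedin_compact_space[OF compact_Y C(1)] continuous_map_collapse
    by (rule image_compactin)
  then show ?thesis using C(2) by (auto simp: kc_space_def)
qed

text \<open>The witness \<open>C\<close>, as a subspace of \<open>Y\<close>, is itself compact
  Hausdorff and is mapped by \<open>q\<close>; hence the refutation is over the type of the points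
  of \<open>Y\<close>.\<close>

lemma not_weakly_Hausdorff: "\<not> weakly_Hausdorff_over TYPE('a) X"
proof -
  obtain C where C: "closedin Y C" "\<not> closedin X (q ` C)" by (rule closed_set_image_not_closed)
  let ?K = "subtopology Y C"
  have "compact_space ?K"
    using closedin_compact_space[OF compact_Y C(1)] by (rule compact_space_subtopology)
  moreover have "Hausdorff_space ?K" using Hausdorff_Y by (rule Hausdorff_space_subtopology)
  moreover have "continuous_map ?K X q"
    using continuous_map_collapse by (rule continuous_map_from_subtopology)
  moreover have "topspace ?K = C" using closedin_subset[OF C(1)] by auto
  ultimately show ?thesis using C(2) unfolding weakly_Hausdorff_over_def by metis
qed

section \<open>Separation of points and connectedness\<close>

lemma t1_space_X: "t1_space X"
  unfolding t1_space_closedin_singleton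
proof
  fix x assume "x \<in> topspace X"
  then show "closedin X {x}"
  proof (cases rule: X_points)
    case 1
    have "collapse_vimage Y A {A} = A" "A \<in> q ` topspace Y"
      using A_subset A_nonempty
      by (auto simp: collapse_vimage_def collapse_eq_self_iff)
        (metis collapse_eq_self_iff image_eqI subsetD)
    then show ?thesis using 1 closed_A by (simp add: closedin_FMQ_dense)
  next
    case (2 y)
    \<comment> \<open>A constant sequence makes the singleton an instance of
      \<open>closedin_X_limit\<close>.\<close>
    then have "limitin Y (\<lambda>n. y) y sequentially" by (simp add: limitin_const_iff)
    then show ?thesis using closedin_X_limit[of "\<lambda>n. y" y] 2 by simp
  qed
qed

text \<open>One of two open sets covering \<open>X\<close> contains the collapsed point; its
  preimage is dense and so meets the nonempty open preimage of the other.\<close>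

lemma connected_space_X: "connected_space X"
  unfolding connected_space_def
proof (intro notI, elim exE conjE)
  have *: False if U: "openin X U" "A \<in> U" and V: "openin X V" "V \<noteq> {}" and "U \<inter> V = {}" for U V
  proof -
    let ?U = "collapse_vimage Y A U" and ?V = "collapse_vimage Y A V"
    have "Y closure_of ?U = topspace Y"
      using U unfolding openin_FMQ_dense by (simp add: FMQ_open_def dense_subsets_def)
    moreover have "openin Y ?V" using V by (simp add: openin_FMQ_dense FMQ_open_def)
    moreover have "?V \<noteq> {}"
      using V openin_subset[OF V(1)] by (fastforce simp: topspace_FMQ_dense collapse_vimage_def)
    ultimately have "?U \<inter> ?V \<noteq> {}" by (simp add: dense_intersects_open)
    then show False using \<open>U \<inter> V = {}\<close> by (auto simp: collapse_vimage_def)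
  qed
  fix U V
  assume UV: "openin X U" "openin X V" "topspace X \<subseteq> U \<union> V" "U \<inter> V = {}" "U \<noteq> {}" "V \<noteq> {}"
  have "A \<in> topspace X"
    unfolding topspace_FMQ_dense using A_nonempty A_subset
    by (metis collapse_eq_self_iff ex_in_conv image_eqI subsetD)
  then show False using UV *[of U V] *[of V U] by blast
qed

section \<open>Uniqueness of sequential limits\<close>

text \<open>Disjoint open sets of \<open>Y\<close> still have disjoint open images once
  \<open>A\<close> is removed from them.\<close>

lemma separation_off_A:
  assumes "x \<in> topspace X" "x' \<in> topspace X" "x \<noteq> A" "x' \<noteq> A" "x \<noteq> x'"
  obtains U V where "openin X U" "openin X V" "x \<in> U" "x' \<in> V" "U \<inter> V = {}"
proof -
  obtain y where y: "y \<in> topspace Y - A" "x = q y" using assms by (metis X_points)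
  obtain y' where y': "y' \<in> topspace Y - A" "x' = q y'" using assms by (metis X_points)
  have "y \<noteq> y'" using y y' assms(5) by auto
  then obtain P Q where PQ: "openin Y P" "openin Y Q" "y \<in> P" "y' \<in> Q" "disjnt P Q"
    using Hausdorff_Y y y' unfolding Hausdorff_space_def by (metis DiffD1)
  have "openin Y (P - A)" "openin Y (Q - A)" using PQ closed_A by (auto intro: openin_diff)
  then have "openin X (q ` (P - A))" "openin X (q ` (Q - A))"
    by (auto intro!: openin_FMQ_dense_image)
  moreover have "q ` (P - A) \<inter> q ` (Q - A) = {}"
    using PQ(5) by (auto simp: collapse_notin disjnt_iff)
  ultimately show thesis using that y y' PQ by blast
qed

text \<open>Off \<open>A\<close> the space \<open>X\<close> carries the topology of \<open>Y\<close>, so convergence there can be tested in \<open>Y\<close>.\<close>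

lemma limitin_lift:
  assumes L: "limitin X s (q y) sequentially" and y: "y \<in> topspace Y - A"
  obtains t N where "range t \<subseteq> topspace Y - A" "limitin Y t y sequentially"
    "\<And>n. s (n + N) = q (t n)"
proof -
  have "eventually (\<lambda>n. s n \<in> q ` (topspace Y - A)) sequentially"
    using L y openin_FMQ_dense_image[OF openin_complement, of A]
    by (auto simp: limitin_def)
  then obtain N where N: "\<And>n. N \<le> n \<Longrightarrow> s n \<in> q ` (topspace Y - A)"
    by (auto simp: eventually_sequentially)
  \<comment> \<open>Finitely many terms of \<open>s\<close> may be the collapsed point, hence the
    offset \<open>N\<close>.\<close>
  then have "\<forall>n. \<exists>z. z \<in> topspace Y - A \<and> s (n + N) = q z" by (metis imageE le_add2)
  then obtain t where t: "\<And>n. t n \<in> topspace Y - A" "\<And>n. s (n + N) = q (t n)" by metis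
  have "limitin Y t y sequentially"
    unfolding limitin_def
  proof (intro conjI allI impI)
    show "y \<in> topspace Y" using y by blast
    fix U assume U: "openin Y U \<and> y \<in> U"
    then have "openin X (q ` (U - A))"
      using closed_A by (intro openin_FMQ_dense_image openin_diff) auto
    moreover have "q y \<in> q ` (U - A)" using U y by blast
    ultimately have "eventually (\<lambda>n. s (n + N) \<in> q ` (U - A)) sequentially"
      using limitin_sequentially_offset[OF L, of N] by (auto simp: limitin_def)
    then show "eventually (\<lambda>n. t n \<in> U) sequentially"
      by eventually_elim (simp add: t(2) collapse_in_image_iff[of "U - A" A] Diff_Int_distrib2)
  qed
  then show thesis using that t by blast
qed

text \<open>A tail of \<open>s\<close> lifts to a sequence converging to \<open>y\<close> in
  \<open>Y\<close>. Its image with \<open>q y\<close> is closed and misses the collapsed point, so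
  \<open>s\<close> would eventually have to leave a set that contains its own tail.\<close>

lemma no_common_limit_with_A:
  assumes "limitin X s A sequentially" "limitin X s (q y) sequentially" "y \<in> topspace Y - A"
  shows False
proof -
  obtain t N where t: "range t \<subseteq> topspace Y - A" "limitin Y t y sequentially"
    "\<And>n. s (n + N) = q (t n)"
    using limitin_lift[OF assms(2,3)] by metis
  let ?F = "q ` insert y (range t)"
  have "openin X (topspace X - ?F)"
    using closedin_X_limit[OF t(2) _ t(1)] assms(3) by blast
  moreover have "A \<notin> ?F" using t(1) assms(3) by (auto simp: collapse_eq_self_iff eq_commute[of A])
  ultimately have "eventually (\<lambda>n. s n \<in> topspace X - ?F) sequentially"
    using assms(1) unfolding limitin_def by blast
  then obtain n where "s (n + N) \<notin> ?F"
    by (metis DiffD2 eventually_sequentially le_add1)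
  then show False using t(3) by auto
qed

lemma US_space_X: "US_space X"
  unfolding US_space_def
proof (intro allI impI, elim conjE)
  fix s :: "nat \<Rightarrow> 'a set" and l m
  assume l: "limitin X s l sequentially" and m: "limitin X s m sequentially"
  then have lX: "l \<in> topspace X" and mX: "m \<in> topspace X" by (auto simp: limitin_def)
  show "l = m"
  proof (rule ccontr)
    assume ne: "l \<noteq> m"
    consider "l = A" | "m = A" | "l \<noteq> A" "m \<noteq> A" by blast
    then show False
    proof cases
      case 1 then show False using mX ne l m no_common_limit_with_A by (metis X_points)
    next
      case 2 then show False using lX ne l m no_common_limit_with_A by (metis X_points)
    next
      case 3
      then obtain U V where UV: "openin X U" "openin X V" "l \<in> U" "m \<in> V" "U \<inter> V = {}"
        using separation_off_A[OF lX mX] ne by metis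
      then have "eventually (\<lambda>n. s n \<in> U) sequentially" "eventually (\<lambda>n. s n \<in> V) sequentially"
        using l m by (auto simp: limitin_def)
      then have "eventually (\<lambda>n. False) sequentially" by eventually_elim (use UV in blast)
      then show False by simp
    qed
  qed
qed

section \<open>Maps from compact Hausdorff spaces\<close>

text \<open>A compact set whose image avoids \<open>q y\<close> cannot have image points accumulating at \<open>q y\<close>:
  otherwise a sequence of image points converges to \<open>q y\<close>, its tails together with \<open>q y\<close> are closed
  in \<open>X\<close>, and by compactness the point common to all of them, which is \<open>q y\<close>, lies in the image.\<close>

lemma compact_preimage_separated:
  fixes K :: "'k topology"
  assumes f: "continuous_map K X f" and K: "compact_space K" and P: "closedin K P"
    and y: "y \<in> topspace Y - A" and base: "countable_nbhd_base_at Y y" and avoid: "q y \<notin> f ` P"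
  obtains V where "openin Y V" "y \<in> V" "V \<inter> A = {}" "f ` P \<inter> q ` V = {}"
proof -
  obtain V where V: "\<And>n. openin Y (V n)" "\<And>n. y \<in> V n"
    and lim: "\<And>p. (\<And>n. p n \<in> V n) \<Longrightarrow> limitin Y p y sequentially"
    using countable_nbhd_base_at_sequence[OF base] y by (metis DiffD1)
  have "\<exists>n. f ` P \<inter> q ` (V n - A) = {}"
  proof (rule ccontr)
    assume "\<not> ?thesis"
    then have "\<forall>n. \<exists>p. p \<in> V n - A \<and> q p \<in> f ` P" by blast
    then obtain p where p: "\<And>n. p n \<in> V n - A" "\<And>n. q (p n) \<in> f ` P" by metis
    have L: "limitin Y p y sequentially" using lim p by blast
    have pY: "p n \<in> topspace Y - A" for n using p(1) openin_subset[OF V(1)] by blast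
    define F where "F k = insert y (range (\<lambda>n. p (n + k)))" for k
    define C where "C k = P \<inter> {a \<in> topspace K. f a \<in> q ` F k}" for k
    have "closedin X (q ` F k)" for k
      unfolding F_def using limitin_sequentially_offset[OF L, of k] y pY
      by (intro closedin_X_limit) auto
    then have "closedin K (C k)" for k
      unfolding C_def using P f by (intro closedin_Int closedin_continuous_map_preimage)
    moreover have "C k \<noteq> {}" for k
    proof -
      obtain a where "a \<in> P" "f a = q (p k)" using p(2)[of k] by force
      moreover have "p k \<in> F k" unfolding F_def by (intro insertI2 range_eqI[of _ _ 0]) simp
      ultimately show ?thesis using closedin_subset[OF P] unfolding C_def by blast
    qed
    moreover have "decseq C"
    proof (rule decseq_SucI)
      fix k
      have "p (n + Suc k) \<in> range (\<lambda>n. p (n + k))" for n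
        by (rule range_eqI[of _ _ "Suc n"]) simp
      then have "F (Suc k) \<subseteq> F k" unfolding F_def by blast
      then show "C (Suc k) \<subseteq> C k" unfolding C_def by blast
    qed
    ultimately obtain a where a: "\<And>k. a \<in> C k"
      using compact_space_imp_nest[OF K, of C] by blast
    obtain z where z: "z \<in> F 0" "f a = q z" using a[of 0] by (auto simp: C_def)
    have disj: "F k \<inter> A = {}" for k using y pY by (auto simp: F_def)
    \<comment> \<open>A priori each \<open>k\<close> yields its own point of \<open>F k\<close> over
      \<open>f a\<close>; injectivity of \<open>q\<close> off \<open>A\<close> makes it always
      \<open>z\<close>.\<close>
    have zF: "z \<in> F k" for k
      using a[of k] z(2) collapse_in_image_iff[OF disj[of k]] by (auto simp: C_def)
    have "z \<noteq> y" using avoid z a[of 0] by (auto simp: C_def)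
    moreover have "z \<in> topspace Y" using z(1) y pY by (auto simp: F_def)
    ultimately have "openin Y (topspace Y - {z})" "y \<in> topspace Y - {z}"
      using y Hausdorff_imp_t1_space[OF Hausdorff_Y] by (auto simp: t1_space_closedin_singleton)
    \<comment> \<open>The complement of \<open>z\<close> is a neighbourhood of the limit
      \<open>y\<close>, so some tail of \<open>p\<close> omits \<open>z\<close>.\<close>
    then obtain N where "\<And>n. N \<le> n \<Longrightarrow> p n \<in> topspace Y - {z}"
      using L unfolding limitin_sequentially by blast
    then have "p (n + N) \<noteq> z" for n by (metis Diff_iff insertI1 le_add2)
    then have "z \<notin> F N" using \<open>z \<noteq> y\<close> by (auto simp: F_def)
    then show False using zF by blast
  qed
  then obtain n where "f ` P \<inter> q ` (V n - A) = {}" by blast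
  moreover have "openin Y (V n - A)" using V(1) closed_A by (rule openin_diff)
  ultimately show thesis using that[of "V n - A"] V(2) y by blast
qed

text \<open>If \<open>f a\<close> is the collapsed point, then \<open>f a\<close> and
  \<open>f b\<close> have no disjoint neighbourhoods in \<open>X\<close>, so the separation is done
  in \<open>K\<close>: a closed neighbourhood of \<open>a\<close> has an image avoiding some open
  \<open>V\<close> around the point below \<open>f b\<close>, and \<open>Q\<close> is the preimage
  of the image of \<open>V\<close>.\<close>

lemma separation_from_A:
  fixes K :: "'k topology"
  assumes f: "continuous_map K X f" and K: "compact_space K" "Hausdorff_space K"
    and base: "\<forall>y\<in>topspace Y - A. countable_nbhd_base_at Y y"
    and a: "a \<in> topspace K" and b: "b \<in> topspace K" and ne: "f a \<noteq> f b" "f b \<noteq> A"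
  obtains P Q where "openin K P" "openin K Q" "a \<in> P" "b \<in> Q" "f ` P \<inter> f ` Q = {}"
proof -
  have fX: "f b \<in> topspace X" using f b by (auto simp: continuous_map_def)
  obtain y where y: "y \<in> topspace Y - A" "f b = q y" using fX ne(2) by (metis X_points)
  define T where "T = {c \<in> topspace K. f c \<in> topspace X - {f b}}"
  have "closedin X {f b}" using t1_space_X fX by (auto simp: t1_space_closedin_singleton)
  then have "openin X (topspace X - {f b})" by blast
  then have "openin K T" unfolding T_def using f by (intro openin_continuous_map_preimage)
  moreover have "a \<in> T" using f a ne by (auto simp: T_def continuous_map_def)
  \<comment> \<open>Regularity replaces the open \<open>T\<close> by a closed neighbourhood
    \<open>C\<close> of \<open>a\<close>, as \<open>compact_preimage_separated\<close> needs a
    closed set.\<close>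
  moreover have "neighbourhood_base_of (closedin K) K"
    unfolding neighbourhood_base_of_closedin
    using K by (rule compact_Hausdorff_imp_regular_space)
  ultimately obtain P C where PC: "openin K P" "closedin K C" "a \<in> P" "P \<subseteq> C" "C \<subseteq> T"
    unfolding neighbourhood_base_of by metis
  have "q y \<notin> f ` C" using PC(5) y(2) by (auto simp: T_def)
  then obtain V where V: "openin Y V" "y \<in> V" "V \<inter> A = {}" "f ` C \<inter> q ` V = {}"
    using compact_preimage_separated[OF f K(1) PC(2) y(1)] base y(1) by metis
  let ?Q = "{c \<in> topspace K. f c \<in> q ` V}"
  have "openin K ?Q"
    using f openin_FMQ_dense_image[OF V(1,3)] by (rule openin_continuous_map_preimage)
  moreover have "b \<in> ?Q" using b y V by auto
  moreover have "f ` P \<inter> f ` ?Q = {}" using V(4) PC(4) by blast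
  ultimately show thesis using that PC by blast
qed

text \<open>At most one of two distinct values is the collapsed point, so
  \<open>separation_from_A\<close> applies, if need be with \<open>a\<close> and \<open>b\<close>
  exchanged. Disjoint images keep the box \<open>P \<times> Q\<close> away from the set of pairs
  with equal values.\<close>

lemma k2_Hausdorff_X:
  assumes base: "\<forall>y\<in>topspace Y - A. countable_nbhd_base_at Y y"
  shows "k2_Hausdorff_over TYPE('k) X"
  unfolding k2_Hausdorff_over_def
proof (intro allI impI, elim conjE)
  fix K :: "'k topology" and f
  assume K: "compact_space K" "Hausdorff_space K" and f: "continuous_map K X f"
  let ?E = "{(a, b). a \<in> topspace K \<and> b \<in> topspace K \<and> f a = f b}"
  have "openin (prod_topology K K) (topspace (prod_topology K K) - ?E)"
    unfolding openin_prod_topology_alt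
  proof (intro allI impI)
    fix a b assume "(a, b) \<in> topspace (prod_topology K K) - ?E"
    then have ab: "a \<in> topspace K" "b \<in> topspace K" "f a \<noteq> f b" by auto
    obtain P Q where PQ: "openin K P" "openin K Q" "a \<in> P" "b \<in> Q" "f ` P \<inter> f ` Q = {}"
    proof (cases "f b = A")
      case False
      then show thesis using separation_from_A[OF f K base ab(1,2)] ab(3) that by metis
    next
      case True
      then have "f a \<noteq> A" using ab(3) by simp
      then show thesis
        using separation_from_A[OF f K base ab(2,1)] ab(3) that by (metis inf_commute)
    qed
    then show "\<exists>P Q. openin K P \<and> openin K Q \<and> a \<in> P \<and> b \<in> Q \<and>
        P \<times> Q \<subseteq> topspace (prod_topology K K) - ?E"
      using openin_subset[OF PQ(1)] openin_subset[OF PQ(2)] by (intro exI[of _ P] exI[of _ Q]) auto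
  qed
  then show "closedin (prod_topology K K) ?E"
    by (auto simp: closedin_def)
qed

end

theorem theorem7p6:
  fixes Y :: "'a topology" and A :: "'a set" and X :: "'a set topology"
  assumes "compact_space Y" and "Hausdorff_space Y" and "no_isolated_points Y"
    and "A \<noteq> {}" and "closedin Y A" and "nowhere_dense_in Y A"
    and "X = FMQ Y A (dense_subsets Y)"
  shows "compact_space X \<and> t1_space X \<and> connected_space X \<and> US_space X \<and>
           \<not> kc_space X \<and> \<not> Hausdorff_space X \<and>
         ((\<forall>y \<in> topspace Y - A. countable_nbhd_base_at Y y) \<longrightarrow>
           k2_Hausdorff_over TYPE('k) X \<and> \<not> weakly_Hausdorff_over TYPE('a) X \<and>
           \<not> kc_space X \<and> \<not> Hausdorff_space X)"
proof -
  interpret collapsed_space Y A using assms by unfold_locales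
  \<comment> \<open>Hausdorff spaces are KC, so the failure of KC also rules out Hausdorff.\<close>
  show ?thesis
    unfolding assms(7)
    using compact_space_FMQ_dense[OF compact_Y] t1_space_X connected_space_X US_space_X not_kc_space
      Hausdorff_imp_kc_space
      k2_Hausdorff_X not_weakly_Hausdorff
    by blast
qed

end
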